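(* Let $\alpha_r,\ \delta_r,\ u_r,\ v_r,\ \delta'_r,\ u'_r,\ v'_r,\ \delta''_r,\ u''_r$ and $v''_r$ be any functions of $r$ only. If $$\beta_{(n,l,k)}=\sum_{m=0}^{\min(n,l,k)}\alpha_m\,u_{n-m}\,u'_{l-m}\,u''_{k-m}\,v_{n+m}\,v'_{l+m}\,v''_{k+m}$$ and $$\gamma_m=\sum_{n=m}^{\infty}\sum_{l=m}^{\infty}\sum_{k=m}^\infty\delta_n\,\delta'_l\,\delta''_k\,u_{n-m}\,u'_{l-m}\,u''_{k-m}\,v_{n+m}\,v'_{l+m}\,v''_{k+m},$$ then, subject to convergence conditions, $$\sum_{m=0}^\infty\alpha_m\gamma_m=\sum_{n,l,k=0}^\infty\beta_{(n,l,k)}\,\delta_n\,\delta'_l\,\delta''_k .$$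
   Context: Here $n,l,k,m$ are non-negative integers, and $r$ is a non-negative integer index. The phrase "subject to convergence conditions" is the paper's own; the paper does not specify the conditions further in the statement. Its proof rearranges the series $\sum_{m=0}^\infty\sum_{n=m}^\infty\sum_{l=m}^\infty\sum_{k=m}^\infty \alpha_m\,\delta_n\,\delta'_l\,\delta''_k\,u_{n-m}\,u'_{l-m}\,u''_{k-m}\,v_{n+m}\,v'_{l+m}\,v''_{k+m}$ under the assumption that this series is convergent. *)

theory Defs
  imports "HOL-Analysis.Infinite_Sum"
begin

end

theory Submission
  imports Defs
begin

text \<open>Both sides sum the same four-index term over the same set of quadruples with m \<le> n,
  m \<le> l and m \<le> k. Grouping by m and factoring out \<open>\<alpha> m\<close> gives the terms
  \<alpha> m * \<gamma> m; grouping by (n, l, k) leaves the finite range m \<le> min(n, l, k) and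
  gives \<beta> n l k times the \<delta> factors. Absolute convergence makes the term
  unconditionally summable over the quadruples, so Fubini applies to either grouping and also yields
  summability of both outer series. Since \<gamma> is an iterated sum,
  \<open>infsum_triple_banach\<close> first merges it into one sum over triples; completeness
  supplies, via \<open>summable_on_Sigma_section\<close>, the summability of each slice that this
  requires.\<close>

lemma summable_on_Sigma_section:
  fixes f :: "'b \<Rightarrow> 'c \<Rightarrow> 'a :: banach"
  assumes "(\<lambda>(x, y). f x y) summable_on Sigma A B" and "x \<in> A"
  shows "f x summable_on B x"
proof -
  have "(\<lambda>(x, y). f x y) summable_on (Pair x ` B x)"
    by (rule summable_on_subset_banach[OF assms(1)]) (use assms(2) in auto)
  then show ?thesis
    by (subst (asm) summable_on_reindex) (auto simp: inj_on_def o_def)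
qed

text \<open>Fubini applied twice, from the inside out; the inner use needs summability on the slice
  at each fixed \<open>x\<close>.\<close>

lemma infsum_triple_banach:
  fixes f :: "'b \<Rightarrow> 'c \<Rightarrow> 'd \<Rightarrow> 'a :: banach"
  assumes "(\<lambda>(x, y, z). f x y z) summable_on A \<times> B \<times> C"
  shows "(\<Sum>\<^sub>\<infinity>x\<in>A. \<Sum>\<^sub>\<infinity>y\<in>B. \<Sum>\<^sub>\<infinity>z\<in>C. f x y z) =
         (\<Sum>\<^sub>\<infinity>(x, y, z)\<in>A \<times> B \<times> C. f x y z)"
proof -
  have "(\<Sum>\<^sub>\<infinity>y\<in>B. \<Sum>\<^sub>\<infinity>z\<in>C. f x y z) = (\<Sum>\<^sub>\<infinity>(y, z)\<in>B \<times> C. f x y z)" if "x \<in> A" for x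
    by (rule infsum_Sigma'_banach) (use summable_on_Sigma_section[OF assms that] in simp)
  then have "(\<Sum>\<^sub>\<infinity>x\<in>A. \<Sum>\<^sub>\<infinity>y\<in>B. \<Sum>\<^sub>\<infinity>z\<in>C. f x y z) =
      (\<Sum>\<^sub>\<infinity>x\<in>A. \<Sum>\<^sub>\<infinity>(y, z)\<in>B \<times> C. f x y z)"
    by (intro infsum_cong)
  also have "\<dots> = (\<Sum>\<^sub>\<infinity>(x, y, z)\<in>A \<times> B \<times> C. f x y z)"
    by (rule infsum_Sigma'_banach[OF assms])
  finally show ?thesis .
qed

theorem theorem2p2:
  fixes \<alpha> \<delta> u v \<delta>' u' v' \<delta>'' u'' v'' \<gamma> :: "nat \<Rightarrow> 'a :: {real_normed_field, banach}"
    and \<beta> :: "nat \<Rightarrow> nat \<Rightarrow> nat \<Rightarrow> 'a"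
  assumes \<beta>: "\<And>n l k. \<beta> n l k =
      (\<Sum>m=0..Min {n, l, k}. \<alpha> m * u (n - m) * u' (l - m) * u'' (k - m)
                              * v (n + m) * v' (l + m) * v'' (k + m))"
    and \<gamma>: "\<And>m. \<gamma> m =
      (\<Sum>\<^sub>\<infinity>n\<in>{m..}. \<Sum>\<^sub>\<infinity>l\<in>{m..}. \<Sum>\<^sub>\<infinity>k\<in>{m..}.
         \<delta> n * \<delta>' l * \<delta>'' k * u (n - m) * u' (l - m) * u'' (k - m)
         * v (n + m) * v' (l + m) * v'' (k + m))"
    and convergence:
      "(\<lambda>(m, n, l, k). \<alpha> m * \<delta> n * \<delta>' l * \<delta>'' k * u (n - m) * u' (l - m) * u'' (k - m)
                       * v (n + m) * v' (l + m) * v'' (k + m))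
         abs_summable_on {(m, n, l, k). m \<le> n \<and> m \<le> l \<and> m \<le> k}"
  shows "(\<lambda>m. \<alpha> m * \<gamma> m) summable_on UNIV \<and>
         (\<lambda>(n, l, k). \<beta> n l k * \<delta> n * \<delta>' l * \<delta>'' k) summable_on UNIV \<and>
         (\<Sum>\<^sub>\<infinity>m. \<alpha> m * \<gamma> m) =
         (\<Sum>\<^sub>\<infinity>(n, l, k). \<beta> n l k * \<delta> n * \<delta>' l * \<delta>'' k)"
proof -
  define T where "T m n l k = \<alpha> m * \<delta> n * \<delta>' l * \<delta>'' k * u (n - m) * u' (l - m) * u'' (k - m)
                       * v (n + m) * v' (l + m) * v'' (k + m)" for m n l k
  \<comment> \<open>\<open>M\<close> and \<open>N\<close> hold the same quadruples, fibred over m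
    and over (n, l, k) respectively. They match because m \<le> min(n, l, k) exactly when m is below
    each of n, l and k.\<close>
  define M where "M = (SIGMA m:(UNIV :: nat set). {m..} \<times> {m..} \<times> {m..})"
  define N where "N = (SIGMA x:(UNIV :: (nat \<times> nat \<times> nat) set).
    case x of (n, l, k) \<Rightarrow> {0..Min {n, l, k}})"
  have "{(m, n, l, k). m \<le> n \<and> m \<le> l \<and> m \<le> k} = M"
    by (auto simp: M_def)
  with convergence have M: "(\<lambda>(m, n, l, k). T m n l k) summable_on M"
    by (auto simp: T_def intro: abs_summable_summable)
  have bij: "bij_betw (\<lambda>((n, l, k), m). (m, n, l, k)) N M"
    by (rule bij_betwI[where g = "\<lambda>(m, n, l, k). ((n, l, k), m)"]) (auto simp: M_def N_def)
  have swap: "(\<lambda>x. (\<lambda>(m, n, l, k). T m n l k) ((\<lambda>((n, l, k), m). (m, n, l, k)) x)) =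
      (\<lambda>(x, m). case x of (n, l, k) \<Rightarrow> T m n l k)"
    by auto
  have N: "(\<lambda>(x, m). case x of (n, l, k) \<Rightarrow> T m n l k) summable_on N"
    using M summable_on_reindex_bij_betw[OF bij, of "\<lambda>(m, n, l, k). T m n l k"]
    by (simp only: swap)
  have MN: "(\<Sum>\<^sub>\<infinity>(x, m)\<in>N. case x of (n, l, k) \<Rightarrow> T m n l k) = (\<Sum>\<^sub>\<infinity>(m, n, l, k)\<in>M. T m n l k)"
    using infsum_reindex_bij_betw[OF bij, of "\<lambda>(m, n, l, k). T m n l k"]
    by (simp only: swap)

  have \<alpha>\<gamma>: "\<alpha> m * \<gamma> m = (\<Sum>\<^sub>\<infinity>(n, l, k)\<in>{m..} \<times> {m..} \<times> {m..}. T m n l k)" for m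
  proof -
    have "\<alpha> m * \<gamma> m = (\<Sum>\<^sub>\<infinity>n\<in>{m..}. \<Sum>\<^sub>\<infinity>l\<in>{m..}. \<Sum>\<^sub>\<infinity>k\<in>{m..}. T m n l k)"
      \<comment> \<open>Over a field, moving \<open>\<alpha> m\<close> inside each infinite sum
        needs no summability: a nonzero factor is invertible, and a zero factor makes both sides
        0.\<close>
      unfolding \<gamma> infsum_cmult_right'[symmetric] by (simp add: T_def mult_ac)
    also have "\<dots> = (\<Sum>\<^sub>\<infinity>(n, l, k)\<in>{m..} \<times> {m..} \<times> {m..}. T m n l k)"
      by (rule infsum_triple_banach)
        (use summable_on_Sigma_section[OF M[unfolded M_def], of m] in simp)
    finally show ?thesis .
  qed
  \<comment> \<open>The fibre of \<open>N\<close> over a triple is finite, so its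
    \<open>infsum\<close> is the finite sum defining \<beta>. The \<open>case\<close> form matches
    the fibres of \<open>N\<close>, so that the Fubini rules apply to the rewritten goal.\<close>
  have \<beta>\<delta>: "(case x of (n, l, k) \<Rightarrow> \<beta> n l k * \<delta> n * \<delta>' l * \<delta>'' k) =
      (\<Sum>\<^sub>\<infinity>m\<in>(case x of (n, l, k) \<Rightarrow> {0..Min {n, l, k}}). case x of (n, l, k) \<Rightarrow> T m n l k)" for x
  proof (cases x)
    case (fields n l k)
    have "\<beta> n l k * \<delta> n * \<delta>' l * \<delta>'' k = (\<Sum>m=0..Min {n, l, k}. T m n l k)"
      unfolding \<beta> sum_distrib_right T_def by (intro sum.cong refl) (simp only: mult_ac)
    then show ?thesis
      using fields by simp
  qed

  show ?thesis
    unfolding \<alpha>\<gamma> \<beta>\<delta>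
    using summable_on_Sigma_banach[OF M[unfolded M_def]] infsum_Sigma'_banach[OF M[unfolded M_def]]
      summable_on_Sigma_banach[OF N[unfolded N_def]] infsum_Sigma'_banach[OF N[unfolded N_def]]
      MN[unfolded M_def N_def]
    by simp
qed

end
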